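(* The integrality gap of the subtour LP restricted to symmetric circulant TSP instances is at most $2$: for every $n\ge3$ and every $(c_1,\dots,c_d)\in\mathbb{R}^d_{\ge0}$ (with $d=\lfloor n/2\rfloor$), $\mathrm{TSPOPT}(c_1,\dots,c_d)\le 2\,\mathrm{LPOPT}(c_1,\dots,c_d)$.
   Context: A symmetric circulant TSP instance on $K_n$ (vertices $[n]$, arithmetic mod $n$) is given by stripe costs $c_1,\dots,c_d\ge0$: edge $\{i,j\}$ has cost $c_k$ where $k=\min\{(i-j)\bmod n,(j-i)\bmod n\}$. $\mathrm{TSPOPT}$ is the minimum cost of a Hamiltonian cycle in $K_n$. $\mathrm{LPOPT}$ is the optimal value of the subtour LP: minimize $\sum_{e}c_ex_e$ subject to $\sum_{e\in\delta(v)}x_e=2$ for all vertices $v$, $\sum_{e\in\delta(S)}x_e\ge2$ for all $\emptyset\neq S\subsetneq[n]$, $0\le x_e\le1$, where $\delta(S)$ is the set of edges with exactly one endpoint in $S$. *)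

theory Defs
  imports Complex_Main
begin

section \<open>The complete graph on \<open>{1..n}\<close> and circulant edge costs\<close>

definition edges :: "nat \<Rightarrow> nat set set" where
  "edges n = {e. e \<subseteq> {1..n} \<and> card e = 2}"

definition stripe :: "nat \<Rightarrow> nat \<Rightarrow> nat \<Rightarrow> nat" where
  "stripe n i j = nat (min ((int i - int j) mod int n) ((int j - int i) mod int n))"

text \<open>Since \<open>stripe\<close> is symmetric, the choice of \<open>Min e\<close> and \<open>Max e\<close> to name the two
  endpoints of an edge is immaterial; see \<open>edge_cost_doubleton\<close>.\<close>

definition edge_cost :: "nat \<Rightarrow> (nat \<Rightarrow> real) \<Rightarrow> nat set \<Rightarrow> real" where
  "edge_cost n c e = c (stripe n (Min e) (Max e))"

lemma stripe_commute: "stripe n i j = stripe n j i"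
  by (simp add: stripe_def min.commute)

lemma edge_cost_doubleton: "edge_cost n c {i, j} = c (stripe n i j)"
  using stripe_commute[of n i j] by (cases "i \<le> j") (simp_all add: edge_cost_def)

text \<open>Every edge lies in one of the stripes \<open>1, \<dots>, n div 2\<close>, so only these values of a cost
  function \<open>c\<close> matter.\<close>

lemma stripe_range:
  assumes "i \<in> {1..n}" "j \<in> {1..n}" "i \<noteq> j"
  shows "stripe n i j \<in> {1..n div 2}"
proof -
  have *: "stripe n i j \<in> {1..n div 2}" if "i \<in> {1..n}" "j \<in> {1..n}" "i < j" for i j
  proof -
    have b: "(int j - int i) mod int n = int j - int i"
      using that by (intro mod_pos_pos_trivial) auto
    have "(int i - int j) mod int n = (int i - int j + int n) mod int n"
      by simp
    also have "\<dots> = int i - int j + int n"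
      using that by (intro mod_pos_pos_trivial) auto
    finally show ?thesis
      using that unfolding stripe_def b by (auto simp: min_def)
  qed
  from assms show ?thesis
    using *[of i j] *[of j i] stripe_commute[of n i j] by (cases "i < j") auto
qed


section \<open>Optimal tours\<close>

text \<open>A Hamiltonian cycle is represented by its set of edges. For \<open>n \<ge> 3\<close> the \<open>n\<close> edges listed
  below are distinct, so summing over the set counts every edge of the cycle once.\<close>

definition hamiltonian_cycle :: "nat \<Rightarrow> nat set set \<Rightarrow> bool" where
  "hamiltonian_cycle n H \<longleftrightarrow>
     (\<exists>vs. distinct vs \<and> set vs = {1..n} \<and> H = {{vs ! i, vs ! (Suc i mod n)} | i. i < n})"

definition TSPOPT :: "nat \<Rightarrow> (nat \<Rightarrow> real) \<Rightarrow> real" where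
  "TSPOPT n c = Min ((\<lambda>H. \<Sum>e\<in>H. edge_cost n c e) ` {H. hamiltonian_cycle n H})"

lemma hamiltonian_cycle_exists: "\<exists>H. hamiltonian_cycle n H"
proof -
  have "distinct [1..<Suc n] \<and> set [1..<Suc n] = {1..n}"
    by (metis distinct_upt set_upt atLeastLessThanSuc_atLeastAtMost)
  then show ?thesis
    unfolding hamiltonian_cycle_def by blast
qed

lemma finite_hamiltonian_cycles: "finite {H. hamiltonian_cycle n H}"
proof (rule finite_subset)
  show "{H. hamiltonian_cycle n H} \<subseteq> Pow (Pow {1..n})"
  proof safe
    fix H e v assume "hamiltonian_cycle n H" and ev: "e \<in> H" "v \<in> e"
    then obtain vs where vs: "distinct vs" "set vs = {1..n}"
      "H = {{vs ! i, vs ! (Suc i mod n)} | i. i < n}"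
      unfolding hamiltonian_cycle_def by blast
    have "length vs = n"
      using distinct_card[OF vs(1)] vs(2) by simp
    then have "vs ! i \<in> {1..n} \<and> vs ! (Suc i mod n) \<in> {1..n}" if "i < n" for i
      using that vs(2) nth_mem[of _ vs] by (metis mod_less_divisor not_less_zero gr0I)
    then show "v \<in> {1..n}"
      using ev vs(3) by blast
  qed
qed simp

lemma card_hamiltonian_cycle:
  assumes "n \<ge> 3" "hamiltonian_cycle n H"
  shows "card H = n"
proof -
  obtain vs where vs: "distinct vs" "set vs = {1..n}"
    "H = {{vs ! i, vs ! (Suc i mod n)} | i. i < n}"
    using assms(2) unfolding hamiltonian_cycle_def by blast
  have len: "length vs = n"
    using distinct_card[OF vs(1)] vs(2) by simp
  have "inj_on (\<lambda>i. {vs ! i, vs ! (Suc i mod n)}) {..<n}"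
  proof (rule inj_onI)
    fix i j assume ij: "i \<in> {..<n}" "j \<in> {..<n}"
      and eq: "{vs ! i, vs ! (Suc i mod n)} = {vs ! j, vs ! (Suc j mod n)}"
    have lt: "i < n" "j < n" "Suc i mod n < n" "Suc j mod n < n"
      using ij assms(1) by auto
    have "i = j \<or> (i = Suc j mod n \<and> Suc i mod n = j)"
      using eq lt vs(1) len by (auto simp: doubleton_eq_iff nth_eq_iff_index_eq)
    then show "i = j"
      using lt assms(1) by (auto simp: mod_Suc split: if_splits)
  qed
  moreover have "H = (\<lambda>i. {vs ! i, vs ! (Suc i mod n)}) ` {..<n}"
    using vs(3) by auto
  ultimately show ?thesis
    by (simp add: card_image)
qed


section \<open>The subtour linear program\<close>

definition delta :: "nat \<Rightarrow> nat set \<Rightarrow> nat set set" where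
  "delta n S = {e \<in> edges n. card (e \<inter> S) = 1}"

definition subtour_feasible :: "nat \<Rightarrow> (nat set \<Rightarrow> real) \<Rightarrow> bool" where
  "subtour_feasible n x \<longleftrightarrow>
     (\<forall>v\<in>{1..n}. (\<Sum>e\<in>delta n {v}. x e) = 2) \<and>
     (\<forall>S. S \<noteq> {} \<and> S \<subset> {1..n} \<longrightarrow> (\<Sum>e\<in>delta n S. x e) \<ge> 2) \<and>
     (\<forall>e\<in>edges n. 0 \<le> x e \<and> x e \<le> 1)"

definition LPOPT :: "nat \<Rightarrow> (nat \<Rightarrow> real) \<Rightarrow> real" where
  "LPOPT n c = Inf ((\<lambda>x. \<Sum>e\<in>edges n. edge_cost n c e * x e) ` {x. subtour_feasible n x})"

text \<open>For \<open>n \<ge> 3\<close> and nonnegative costs the infimum ranges over a nonempty set that is bounded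
  below, so it is not an arbitrary default value.\<close>

lemma finite_edges: "finite (edges n)"
  by (rule finite_subset[of _ "Pow {1..n}"]) (auto simp: edges_def)

lemma card_delta:
  assumes "S \<subseteq> {1..n}"
  shows "card (delta n S) = card S * (n - card S)"
proof -
  have fin: "finite S"
    using assms finite_subset by blast
  have "delta n S = (\<lambda>(u, v). {u, v}) ` (S \<times> ({1..n} - S))"
  proof (intro equalityI subsetI)
    fix e assume e: "e \<in> delta n S"
    have "card (e \<inter> S) = 1" "card e = 2"
      using e by (simp_all add: delta_def edges_def)
    obtain u where u: "e \<inter> S = {u}"
      using \<open>card (e \<inter> S) = 1\<close> by (rule card_1_singletonE)
    obtain a b where ab: "e = {a, b}" "a \<noteq> b"
      using \<open>card e = 2\<close> unfolding card_2_iff by blast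
    have "e \<subseteq> {1..n}"
      using e by (auto simp: delta_def edges_def)
    moreover have "u \<in> {a, b} \<and> u \<in> S \<and> (\<forall>w\<in>{a, b}. w \<in> S \<longrightarrow> w = u)"
      using u unfolding ab(1) by (metis Int_iff singletonD singletonI)
    ultimately have "(a, b) \<in> S \<times> ({1..n} - S) \<or> (b, a) \<in> S \<times> ({1..n} - S)"
      using ab by (simp add: mem_Times_iff) metis
    moreover have "e = (\<lambda>(u, v). {u, v}) (a, b)" "e = (\<lambda>(u, v). {u, v}) (b, a)"
      using ab by auto
    ultimately show "e \<in> (\<lambda>(u, v). {u, v}) ` (S \<times> ({1..n} - S))"
      by (metis imageI)
  next
    fix e assume "e \<in> (\<lambda>(u, v). {u, v}) ` (S \<times> ({1..n} - S))"
    then obtain u v where uv: "e = {u, v}" "u \<in> S" "v \<in> {1..n}" "v \<notin> S"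
      by auto
    then have "e \<inter> S = {u}" "u \<noteq> v" "e \<subseteq> {1..n}"
      using assms by auto
    then show "e \<in> delta n S"
      using uv(1) by (simp add: delta_def edges_def)
  qed
  moreover have "inj_on (\<lambda>(u, v). {u, v}) (S \<times> ({1..n} - S))"
    by (auto simp: inj_on_def doubleton_eq_iff)
  ultimately have "card (delta n S) = card (S \<times> ({1..n} - S))"
    by (simp add: card_image)
  then show ?thesis
    using assms fin by (simp add: card_cartesian_product card_Diff_subset)
qed

lemma subtour_feasible_uniform:
  assumes "n \<ge> 3"
  shows "subtour_feasible n (\<lambda>_. 2 / (real n - 1))"
  unfolding subtour_feasible_def
proof (intro conjI ballI allI impI)
  fix v assume "v \<in> {1..n}"
  then show "(\<Sum>e\<in>delta n {v}. 2 / (real n - 1)) = 2"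
    using assms by (simp add: card_delta of_nat_diff field_simps)
next
  fix S assume S: "S \<noteq> {} \<and> S \<subset> {1..n}"
  then have "finite S"
    using finite_subset by blast
  with S have "card S \<ge> 1"
    by (simp add: Suc_le_eq card_gt_0_iff)
  moreover have "card S < n"
    using S psubset_card_mono[of "{1..n}" S] by simp
  ultimately have "(real (card S) - 1) * (real n - real (card S) - 1) \<ge> 0"
    by (intro mult_nonneg_nonneg) auto
  then have "real (card S) * (real n - real (card S)) \<ge> real n - 1"
    by (simp add: algebra_simps)
  moreover have "card (delta n S) = card S * (n - card S)"
    using S by (intro card_delta) auto
  ultimately have "real (card (delta n S)) \<ge> real n - 1"
    using \<open>card S < n\<close> by (simp add: of_nat_diff)
  then show "(\<Sum>e\<in>delta n S. 2 / (real n - 1)) \<ge> 2"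
    using assms by (simp add: field_simps)
qed (use assms in \<open>auto simp: field_simps\<close>)

lemma LP_objective_nonneg:
  assumes "\<And>k. k \<in> {1..n div 2} \<Longrightarrow> c k \<ge> 0" "subtour_feasible n x"
  shows "(\<Sum>e\<in>edges n. edge_cost n c e * x e) \<ge> 0"
proof (rule sum_nonneg)
  fix e assume e: "e \<in> edges n"
  then obtain i j where ij: "e = {i, j}" "i \<noteq> j" "i \<in> {1..n}" "j \<in> {1..n}"
    by (auto simp: edges_def card_2_iff)
  then have "edge_cost n c e \<ge> 0"
    using assms(1)[OF stripe_range[of i n j]] by (simp add: edge_cost_doubleton)
  then show "edge_cost n c e * x e \<ge> 0"
    using assms(2) e by (simp add: subtour_feasible_def)
qed

end

theory Submission
  imports Defs
begin

text \<open>
  List the stripes by increasing cost, and let \<open>G i\<close> be the gcd of \<open>n\<close> and the first \<open>i\<close> of them,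
  so that the first \<open>i\<close> stripes alone split the vertices into \<open>G i\<close> residue classes. Both optima
  are compared with the minimum spanning tree cost, in which the \<open>i\<close>-th stripe \<open>s\<^sub>i\<close> is used
  \<open>G (i - 1) - G i\<close> times.

  Lower bound: adding up the cut constraints of the residue classes modulo \<open>G i\<close> shows that edges
  outside the first \<open>i\<close> stripes carry total weight at least \<open>G i\<close> (if \<open>G i > 1\<close>), and summation by
  parts yields the tree cost.

  Upper bound: a cycle through one class modulo \<open>G (i - 1)\<close> is turned into a cycle through one class
  modulo \<open>G i\<close> by placing translates by \<open>s\<^sub>i\<close> side by side and traversing them in a snake that
  leaves out one vertex per translate for the way back. This uses the stripe \<open>s\<^sub>i\<close> twice for each of
  its edges in the tree and otherwise pays for no more than the translates, so that no triangle
  inequality is required.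
\<close>

section \<open>Weights of walks\<close>

fun path_weight :: "(int \<Rightarrow> real) \<Rightarrow> int list \<Rightarrow> real" where
  "path_weight w (u # v # vs) = w (v - u) + path_weight w (v # vs)"
| "path_weight w _ = 0"

text \<open>The closing edge is added even for a one-element list, where it contributes
  \<open>w 0\<close>.\<close>

definition cycle_weight :: "(int \<Rightarrow> real) \<Rightarrow> int list \<Rightarrow> real" where
  "cycle_weight w vs = path_weight w vs + w (hd vs - last vs)"

lemma path_weight_Cons:
  "vs \<noteq> [] \<Longrightarrow> path_weight w (u # vs) = w (hd vs - u) + path_weight w vs"
  by (cases vs) auto

lemma path_weight_append:
  "us \<noteq> [] \<Longrightarrow> vs \<noteq> [] \<Longrightarrow>
    path_weight w (us @ vs) = path_weight w us + w (hd vs - last us) + path_weight w vs"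
  by (induction us) (auto simp: path_weight_Cons)

lemma path_weight_translate: "path_weight w (map (\<lambda>v. v + t) vs) = path_weight w vs"
  by (induction w vs rule: path_weight.induct) auto

lemma path_weight_rev:
  assumes "\<And>x. w (- x) = w x"
  shows "path_weight w (rev vs) = path_weight w vs"
proof (induction vs)
  case (Cons u vs)
  show ?case
  proof (cases "vs = []")
    case False
    have "w (u - hd vs) = w (hd vs - u)"
      using assms[of "u - hd vs"] by simp
    then show ?thesis
      using False Cons by (simp add: path_weight_append path_weight_Cons last_rev)
  qed simp
qed simp

lemma path_weight_progression:
  "path_weight w (map (\<lambda>j. v + int j * a) [0..<Suc k]) = real k * w a"
proof (induction k)
  case (Suc k)
  let ?p = "map (\<lambda>j. v + int j * a) [0..<Suc k]"
  have "path_weight w (?p @ [v + int (Suc k) * a]) = path_weight w ?p + w a"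
    by (subst path_weight_append) (simp_all add: algebra_simps)
  then show ?case
    using Suc by (simp add: algebra_simps)
qed simp

lemma path_weight_conv_sum:
  "path_weight w vs = (\<Sum>i<length vs - 1. w (vs ! Suc i - vs ! i))"
  by (induction w vs rule: path_weight.induct) (auto simp: sum.lessThan_Suc_shift simp del: sum.lessThan_Suc)

lemma cycle_weight_conv_sum:
  assumes "vs \<noteq> []"
  shows "cycle_weight w vs = (\<Sum>i<length vs. w (vs ! (Suc i mod length vs) - vs ! i))"
proof -
  obtain m where m: "length vs = Suc m"
    using assms by (cases vs) auto
  have "(\<Sum>i<m. w (vs ! Suc i - vs ! i)) = (\<Sum>i<m. w (vs ! (Suc i mod Suc m) - vs ! i))"
    by (rule sum.cong) auto
  then show ?thesis
    using assms m by (simp add: cycle_weight_def path_weight_conv_sum hd_conv_nth last_conv_nth)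
qed


section \<open>Tours of subgroups of the cyclic group\<close>

text \<open>A tour of the subgroup generated by \<open>g\<close> modulo \<open>n\<close> is a list of integers representing
  each element; that nothing is represented twice follows from the length.\<close>

definition subgroup_tour :: "nat \<Rightarrow> nat \<Rightarrow> int list \<Rightarrow> bool" where
  "subgroup_tour n g vs \<longleftrightarrow>
     length vs * g = n \<and> (\<forall>x. int g dvd x \<longrightarrow> (\<exists>v\<in>set vs. int n dvd x - v))"

text \<open>By Bezout every multiple of \<open>gcd g a\<close> is a multiple of \<open>a\<close>
  plus a multiple of \<open>g\<close>. As \<open>k * a\<close> is a multiple of \<open>g\<close>,
  the coefficient of \<open>a\<close> can be reduced modulo \<open>k\<close>, so \<open>k\<close>
  translates suffice.\<close>

lemma subgroup_tour_extend:
  assumes tour: "subgroup_tour n g vs" and "g > 0"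
    and k: "g = k * gcd g a"
    and len: "length us = k * length vs"
    and us: "\<And>v j. v \<in> set vs \<Longrightarrow> j < k \<Longrightarrow> v + int j * int a \<in> set us"
  shows "subgroup_tour n (gcd g a) us"
  unfolding subgroup_tour_def
proof (intro conjI allI impI)
  have "length us * gcd g a = length vs * (k * gcd g a)"
    using len by simp
  also have "\<dots> = n"
    using tour unfolding subgroup_tour_def k[symmetric] by simp
  finally show "length us * gcd g a = n" .
next
  fix x assume "int (gcd g a) dvd x"
  then obtain y where y: "x = int (gcd g a) * y" ..
  obtain b c where "b * int g + c * int a = int (gcd g a)"
    using bezout_int[of "int g" "int a"] by auto
  then have "x = (b * int g + c * int a) * y"
    using y by simp
  then have bez: "x = b * y * int g + c * y * int a"
    by (simp add: algebra_simps)
  have "k > 0"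
    using k \<open>g > 0\<close> by (cases k) auto
  define j where "j = nat ((c * y) mod int k)"
  have j: "j < k" "int j = (c * y) mod int k"
    using \<open>k > 0\<close> by (simp_all add: j_def nat_less_iff)
  have "int g dvd int k * int a"
  proof -
    have "k * gcd g a dvd k * a"
      by (simp add: mult_dvd_mono)
    then show ?thesis
      using k by (metis of_nat_dvd_iff of_nat_mult)
  qed
  moreover have "x - int j * int a = b * y * int g + (c * y) div int k * (int k * int a)"
  proof -
    have "c * y * int a = ((c * y) div int k * int k + int j) * int a"
      unfolding j(2) by (simp only: div_mult_mod_eq)
    then show ?thesis
      unfolding bez by (simp add: algebra_simps)
  qed
  ultimately have "int g dvd x - int j * int a"
    by simp
  then obtain v where "v \<in> set vs" "int n dvd x - int j * int a - v"
    using tour unfolding subgroup_tour_def by blast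
  then show "\<exists>v\<in>set us. int n dvd x - v"
    using us[OF _ j(1)] by (metis add.commute diff_diff_eq)
qed

section \<open>Enlarging a cycle by translates along one further stripe\<close>

locale circulant_weight =
  fixes n :: nat and w :: "int \<Rightarrow> real"
  assumes minus: "w (- x) = w x"
    and periodic: "int n dvd x - y \<Longrightarrow> w x = w y"
    and nonneg: "w x \<ge> 0"
begin

lemma path_weight_nonneg: "path_weight w vs \<ge> 0"
  by (induction vs rule: induct_list012) (auto intro: add_nonneg_nonneg nonneg)

lemma path_weight_rev [simp]: "path_weight w (rev vs) = path_weight w vs"
  using minus by (rule path_weight_rev)

lemma weight_diff_commute: "w (x - y) = w (y - x)"
  using minus[of "x - y"] by simp

text \<open>Consecutive translates are traversed in alternating directions, so each passage joins
  two copies of the same vertex and has weight \<open>w a\<close>. Which end of the last translate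
  is reached depends on the parity of \<open>k\<close>; the disjunction avoids tracking it.\<close>

lemma snake:
  assumes "vs \<noteq> []"
  shows "\<exists>p. p \<noteq> [] \<and> length p = Suc k * length vs \<and> hd p = hd vs \<and>
    (last p = hd vs + int k * a \<or> last p = last vs + int k * a) \<and>
    (\<forall>v\<in>set vs. \<forall>j\<le>k. v + int j * a \<in> set p) \<and>
    path_weight w p = real (Suc k) * path_weight w vs + real k * w a"
proof (induction k)
  case 0
  show ?case
    using assms by (intro exI[of _ vs]) auto
next
  case (Suc k)
  then obtain p where p: "p \<noteq> []" "length p = Suc k * length vs" "hd p = hd vs"
    "last p = hd vs + int k * a \<or> last p = last vs + int k * a"
    "\<forall>v\<in>set vs. \<forall>j\<le>k. v + int j * a \<in> set p"
    "path_weight w p = real (Suc k) * path_weight w vs + real k * w a"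
    by blast
  \<comment> \<open>The next translate starts at the copy of the vertex where \<open>p\<close>
    stopped.\<close>
  define us where "us = (if last p = hd vs + int k * a then vs else rev vs)"
  define q where "q = map (\<lambda>v. v + int (Suc k) * a) us"
  have us: "us \<noteq> []" "set us = set vs" "length us = length vs"
    "path_weight w us = path_weight w vs"
    "last us = hd vs \<or> last us = last vs"
    using assms by (auto simp: us_def last_rev)
  have "hd us + int k * a = last p"
    using p(4) assms by (auto simp: us_def hd_rev)
  then have "hd q - last p = a"
    using us(1) by (simp add: q_def hd_map algebra_simps)
  moreover have "path_weight w q = path_weight w vs"
    unfolding q_def path_weight_translate us(4) ..
  ultimately have "path_weight w (p @ q)
      = real (Suc (Suc k)) * path_weight w vs + real (Suc k) * w a"
    using us(1) p(1,6) by (simp add: q_def path_weight_append algebra_simps)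
  moreover have "v + int j * a \<in> set (p @ q)" if "v \<in> set vs" "j \<le> Suc k" for v j
    using that p(5) us(2) by (cases "j = Suc k") (auto simp: q_def le_Suc_eq)
  moreover have "last (p @ q) = hd vs + int (Suc k) * a \<or> last (p @ q) = last vs + int (Suc k) * a"
    using us(1,5) by (auto simp: q_def last_map)
  ultimately show ?case
    using p(1-3) us(3) by (intro exI[of _ "p @ q"]) (simp add: q_def)
qed

text \<open>The first vertices of the \<open>k + 1\<close> translates form the way back, the remaining ones are
  traversed in a snake. The two edges joining the way back to the snake are translates of edges
  of the given cycle; as \<open>k > 0\<close> they are paid for even if both are translates of the same edge.\<close>

lemma cycle_extend:
  assumes vs: "vs = v0 # rs" "rs \<noteq> []" and "k > 0"
  shows "\<exists>us. length us = Suc k * length vs \<and>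
    (\<forall>v\<in>set vs. \<forall>j\<le>k. v + int j * a \<in> set us) \<and>
    cycle_weight w us \<le> real (Suc k) * cycle_weight w vs + 2 * real k * w a"
proof -
  obtain p where p: "p \<noteq> []" "length p = Suc k * length rs" "hd p = hd rs"
    "last p = hd rs + int k * a \<or> last p = last rs + int k * a"
    "\<forall>v\<in>set rs. \<forall>j\<le>k. v + int j * a \<in> set p"
    "path_weight w p = real (Suc k) * path_weight w rs + real k * w a"
    using snake[OF \<open>rs \<noteq> []\<close>, of k a] by blast
  obtain l where l: "k = Suc l"
    using \<open>k > 0\<close> gr0_implies_Suc by blast
  \<comment> \<open>The copy of \<open>v0\<close> with index 0 is the start of \<open>us\<close>, so
    \<open>q\<close> begins at \<open>v0 + a\<close>, and the edge closing the cycle has weight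
    \<open>w (- a)\<close>.\<close>
  define q where "q = map (\<lambda>j. (v0 + a) + int j * a) [0..<k]"
  define us where "us = v0 # p @ rev q"
  have q: "q \<noteq> []" "hd q = v0 + a" "last q = v0 + int k * a"
    by (simp_all add: q_def l hd_map last_map algebra_simps del: upt_Suc)
  have pq: "path_weight w q = real l * w a"
    unfolding q_def l by (rule path_weight_progression)
  have "v + int j * a \<in> set us" if v: "v \<in> set vs" and j: "j \<le> k" for v j
  proof (cases "v \<in> set rs")
    case True
    then show ?thesis
      using p(5) j by (simp add: us_def)
  next
    case False
    then have "v = v0"
      using v vs by simp
    show ?thesis
    proof (cases j)
      case 0
      then show ?thesis
        using \<open>v = v0\<close> by (simp add: us_def)
    next
      case (Suc i)
      then have "v + int j * a = (v0 + a) + int i * a" "i < k"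
        using \<open>v = v0\<close> j by (auto simp: algebra_simps)
      then have "v + int j * a \<in> set q"
        unfolding q_def by auto
      then show ?thesis
        by (simp add: us_def)
    qed
  qed
  moreover have "length us = Suc k * length vs"
    using p(2) vs by (simp add: us_def q_def)
  moreover have "cycle_weight w us \<le> real (Suc k) * cycle_weight w vs + 2 * real k * w a"
  proof -
    let ?A = "w (hd rs - v0)" and ?B = "w (v0 - last rs)"
    have "cycle_weight w us
        = ?A + path_weight w p + w (v0 + int k * a - last p) + path_weight w q + w (- a)"
      using p(1,3) q
      by (simp add: cycle_weight_def us_def path_weight_Cons path_weight_append hd_rev last_rev)
    \<comment> \<open>The edges along \<open>a\<close> number \<open>k\<close> in the snake and
      \<open>l = k - 1\<close> in \<open>q\<close>, and one more closes the cycle.\<close>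
    also have "\<dots> = ?A + w (v0 + int k * a - last p)
        + real (Suc k) * path_weight w rs + 2 * real k * w a"
      unfolding p(6) pq minus l by (simp add: algebra_simps)
    also have "?A + w (v0 + int k * a - last p) \<le> real (Suc k) * (?A + ?B)"
    proof -
      have "w (v0 + int k * a - last p) \<le> ?A + ?B"
        using p(4) nonneg[of "v0 - last rs"] nonneg[of "hd rs - v0"]
        by (auto simp: weight_diff_commute)
      moreover have "?A \<le> real k * (?A + ?B)"
        using \<open>k > 0\<close> nonneg[of "v0 - last rs"] nonneg[of "hd rs - v0"]
        by (intro order_trans[OF _ mult_right_mono[of 1 "real k" "?A + ?B"]]) auto
      ultimately show ?thesis
        by (simp add: algebra_simps)
    qed
    finally show ?thesis
      using vs by (simp add: cycle_weight_def path_weight_Cons algebra_simps)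
  qed
  ultimately show ?thesis
    by blast
qed

text \<open>A single vertex leaves nothing for a snake, but its translates by \<open>a\<close> close
  up by themselves: \<open>k * a\<close> is congruent to \<open>- a\<close> modulo \<open>n\<close>.
  The number \<open>k + 1\<close> of edges is at most \<open>2 * k\<close> since
  \<open>k > 0\<close>.\<close>

lemma cycle_extend_singleton:
  assumes "int n dvd int (Suc k) * a" "k > 0"
  shows "\<exists>us. length us = Suc k \<and> (\<forall>j\<le>k. v + int j * a \<in> set us) \<and>
    cycle_weight w us \<le> 2 * real k * w a"
proof -
  define us where "us = map (\<lambda>j. v + int j * a) [0..<Suc k]"
  have us: "us \<noteq> []" "hd us = v" "last us = v + int k * a"
    by (simp_all add: us_def hd_map last_map del: upt_Suc)
  have "w (v - (v + int k * a)) = w a"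
    using assms(1) periodic[of "int k * a" "- a"] minus[of a] minus[of "int k * a"]
    by (simp add: algebra_simps)
  then have "cycle_weight w us = real (Suc k) * w a"
    using us unfolding cycle_weight_def us_def path_weight_progression
    by (simp add: algebra_simps)
  also have "\<dots> \<le> 2 * real k * w a"
    using assms(2) nonneg by (intro mult_right_mono) auto
  finally show ?thesis
    by (intro exI[of _ us]) (auto simp: us_def simp del: upt_Suc)
qed

text \<open>The factor \<open>g\<close> gives the cost of copying the tour to all \<open>g\<close>
  cosets. In this scaling the translates of the old tour leave the cost unchanged, and
  \<open>2 * k\<close> new edges for each of the \<open>h = gcd g a\<close> larger cosets make
  \<open>2 * (g - h)\<close> edges along \<open>a\<close>.\<close>

lemma subgroup_tour_step:
  assumes tour: "subgroup_tour n g vs" and "n > 0"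
  shows "\<exists>us. subgroup_tour n (gcd g a) us \<and>
    real (gcd g a) * cycle_weight w us
      \<le> real g * cycle_weight w vs + 2 * (real g - real (gcd g a)) * w (int a)"
proof -
  define h where "h = gcd g a"
  have n: "length vs * g = n"
    using tour by (simp add: subgroup_tour_def)
  then have "g > 0"
    using \<open>n > 0\<close> by (intro gr0I) simp
  have h: "h dvd g" "h dvd a"
    by (simp_all add: h_def)
  obtain k0 where k0: "g = h * k0"
    using h(1) ..
  then obtain k where k: "g = Suc k * h"
    using \<open>g > 0\<close> by (cases k0) auto
  have "\<exists>us. subgroup_tour n h us \<and>
    real h * cycle_weight w us \<le> real g * cycle_weight w vs + 2 * (real g - real h) * w (int a)"
  proof (cases "k = 0")
    case True
    then have "h = g"
      using k by simp
    then show ?thesis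
      using tour by (intro exI[of _ vs]) simp
  next
    case False
    obtain v0 rs where vs: "vs = v0 # rs"
      using n \<open>n > 0\<close> by (cases vs) auto
    have "\<exists>us. length us = Suc k * length vs \<and>
      (\<forall>v\<in>set vs. \<forall>j\<le>k. v + int j * int a \<in> set us) \<and>
      cycle_weight w us \<le> real (Suc k) * cycle_weight w vs + 2 * real k * w (int a)"
    proof (cases "rs = []")
      case True
      have "n = g"
        using n vs True by simp
      moreover have "Suc k * h dvd Suc k * a"
        using h(2) by (rule mult_dvd_mono[OF dvd_refl])
      ultimately have "int n dvd int (Suc k) * int a"
        using k by (simp only: of_nat_dvd_iff flip: of_nat_mult)
      then obtain us where "length us = Suc k" "\<forall>j\<le>k. v0 + int j * int a \<in> set us"
        "cycle_weight w us \<le> 2 * real k * w (int a)"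
        using cycle_extend_singleton[of k "int a" v0] False by blast
      moreover have "cycle_weight w vs \<ge> 0"
        by (simp add: cycle_weight_def path_weight_nonneg nonneg)
      ultimately show ?thesis
        using vs True by (intro exI[of _ us]) (auto intro: add_increasing)
    qed (use cycle_extend[OF vs] False in blast)
    then obtain us where us: "length us = Suc k * length vs"
      "\<forall>v\<in>set vs. \<forall>j\<le>k. v + int j * int a \<in> set us"
      "cycle_weight w us \<le> real (Suc k) * cycle_weight w vs + 2 * real k * w (int a)"
      by blast
    have "subgroup_tour n h us"
      unfolding h_def
      by (rule subgroup_tour_extend[OF tour \<open>g > 0\<close> k[unfolded h_def] us(1)]) (use us(2) in auto)
    moreover have "real h * cycle_weight w us
        \<le> real h * (real (Suc k) * cycle_weight w vs + 2 * real k * w (int a))"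
      using us(3) by (intro mult_left_mono) auto
    moreover have "\<dots> = real g * cycle_weight w vs + 2 * (real g - real h) * w (int a)"
      unfolding k by (simp add: algebra_simps)
    ultimately show ?thesis
      by auto
  qed
  then show ?thesis
    unfolding h_def .
qed

text \<open>The first tour is \<open>[0]\<close> in the trivial subgroup, generated by
  \<open>n\<close>; its weight is \<open>w 0\<close>. Each entry of \<open>as\<close> then enlarges
  the subgroup by \<open>subgroup_tour_step\<close>, and the costs add up.\<close>

lemma subgroup_tour_exists:
  assumes "n > 0" "w 0 = 0"
  shows "\<exists>vs. subgroup_tour n (foldl gcd n as) vs \<and>
    real (foldl gcd n as) * cycle_weight w vs
      \<le> 2 * (\<Sum>i<length as. (real (foldl gcd n (take i as)) - real (foldl gcd n (take (Suc i) as)))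
               * w (int (as ! i)))"
proof (induction as rule: rev_induct)
  case Nil
  show ?case
    using assms by (intro exI[of _ "[0]"]) (simp add: subgroup_tour_def cycle_weight_def)
next
  case (snoc a as)
  let ?g = "foldl gcd n as"
  obtain vs where vs: "subgroup_tour n ?g vs"
    "real ?g * cycle_weight w vs \<le> 2 * (\<Sum>i<length as.
        (real (foldl gcd n (take i as)) - real (foldl gcd n (take (Suc i) as))) * w (int (as ! i)))"
    using snoc by blast
  obtain us where "subgroup_tour n (gcd ?g a) us"
    "real (gcd ?g a) * cycle_weight w us
      \<le> real ?g * cycle_weight w vs + 2 * (real ?g - real (gcd ?g a)) * w (int a)"
    using subgroup_tour_step[OF vs(1) assms(1), of a] by blast
  moreover have "(\<Sum>i<length (as @ [a]). (real (foldl gcd n (take i (as @ [a])))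
        - real (foldl gcd n (take (Suc i) (as @ [a])))) * w (int ((as @ [a]) ! i)))
    = (\<Sum>i<length as. (real (foldl gcd n (take i as)) - real (foldl gcd n (take (Suc i) as)))
        * w (int (as ! i))) + (real ?g - real (gcd ?g a)) * w (int a)"
    by (simp add: nth_append)
  ultimately show ?case
    using vs(2) by (intro exI[of _ us]) (simp add: algebra_simps)
qed

end


section \<open>Circulant costs\<close>

text \<open>The value \<open>c 0\<close> is arbitrary, hence the separate case.\<close>

definition circulant_cost :: "nat \<Rightarrow> (nat \<Rightarrow> real) \<Rightarrow> int \<Rightarrow> real" where
  "circulant_cost n c d =
     (if int n dvd d then 0 else c (nat (min (d mod int n) ((- d) mod int n))))"

lemma circulant_cost_stripe:
  assumes "a \<in> {1..n div 2}"
  shows "circulant_cost n c (int a) = c a"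
proof -
  have "(- int a) mod int n = (- int a + int n) mod int n"
    by simp
  also have "\<dots> = int n - int a"
    using assms by (subst mod_pos_pos_trivial) auto
  finally have "(- int a) mod int n = int n - int a" .
  moreover have "int a mod int n = int a" "\<not> n dvd a"
    using assms by (auto dest: dvd_imp_le)
  ultimately show ?thesis
    using assms by (auto simp: circulant_cost_def min_def)
qed

lemma circulant_weight_circulant_cost:
  assumes "n > 0" "\<And>k. k \<in> {1..n div 2} \<Longrightarrow> c k \<ge> 0"
  shows "circulant_weight n (circulant_cost n c)"
proof
  show "circulant_cost n c (- x) = circulant_cost n c x" for x
    by (simp add: circulant_cost_def min.commute)
  show "circulant_cost n c x = circulant_cost n c y" if "int n dvd x - y" for x y
  proof -
    have "x mod int n = y mod int n"
      using that by (simp add: mod_eq_dvd_iff)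
    moreover from this have "(- x) mod int n = (- y) mod int n"
      by (metis mod_minus_eq)
    ultimately show ?thesis
      by (simp add: circulant_cost_def dvd_eq_mod_eq_0)
  qed
  show "circulant_cost n c x \<ge> 0" for x
  proof (cases "int n dvd x")
    case False
    \<comment> \<open>The vertices \<open>x mod n + 1\<close> and 1 differ by \<open>x\<close>
      modulo \<open>n\<close>, so \<open>stripe_range\<close> applies.\<close>
    have "stripe n (nat (x mod int n) + 1) 1 = nat (min (x mod int n) ((- x) mod int n))"
      using assms(1) by (simp add: stripe_def mod_minus_eq)
    moreover have "x mod int n > 0" "x mod int n < int n"
      using False assms(1) by (auto simp: dvd_eq_mod_eq_0 order.not_eq_order_implies_strict)
    then have "stripe n (nat (x mod int n) + 1) 1 \<in> {1..n div 2}"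
      using assms(1) by (intro stripe_range) (auto simp: Suc_le_eq nat_less_iff)
    ultimately show ?thesis
      using False assms(2) by (simp add: circulant_cost_def)
  qed (simp add: circulant_cost_def)
qed

section \<open>From integer tours to Hamiltonian cycles\<close>

lemma TSPOPT_le_cycle_weight:
  assumes "n \<ge> 3" and c: "\<And>k. k \<in> {1..n div 2} \<Longrightarrow> c k \<ge> 0"
    and tour: "subgroup_tour n 1 vs"
  shows "TSPOPT n c \<le> cycle_weight (circulant_cost n c) vs"
proof -
  have len: "length vs = n" and cov: "\<exists>v\<in>set vs. int n dvd x - v" for x
    using tour by (auto simp: subgroup_tour_def)
  \<comment> \<open>Vertices start at 1, residues at 0; the shift cancels in every
    difference.\<close>
  define f where "f v = nat (v mod int n) + 1" for v
  define us where "us = map f vs"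
  have f: "int (f v) = v mod int n + 1" for v
    using assms(1) by (simp add: f_def)
  have set_us: "set us = {1..n}"
  proof
    have "f v \<in> {1..n}" for v
      using f[of v] pos_mod_bound[of "int n" v] assms(1) unfolding atLeastAtMost_iff
      by (auto simp del: pos_mod_bound) (simp add: f_def)
    then show "set us \<subseteq> {1..n}"
      by (auto simp: us_def)
    show "{1..n} \<subseteq> set us"
    proof
      fix u assume u: "u \<in> {1..n}"
      obtain v where v: "v \<in> set vs" "int n dvd (int u - 1) - v"
        using cov by blast
      have "v mod int n = (int u - 1) mod int n"
        using v(2) by (metis mod_eq_dvd_iff)
      also have "\<dots> = int u - 1"
        using u by (intro mod_pos_pos_trivial) auto
      finally have "f v = u"
        using f[of v] by simp
      then show "u \<in> set us"
        using v(1) by (auto simp: us_def)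
    qed
  qed
  \<comment> \<open>A list of length \<open>n\<close> that covers \<open>n\<close> vertices cannot
    repeat one.\<close>
  have dist: "distinct us"
    using set_us len by (intro card_distinct) (simp add: us_def)
  define E where "E i = {us ! i, us ! (Suc i mod n)}" for i
  have E_cost: "edge_cost n c (E i) \<ge> 0 \<and>
      edge_cost n c (E i) = circulant_cost n c (vs ! (Suc i mod n) - vs ! i)" if "i < n" for i
  proof -
    let ?j = "Suc i mod n"
    have j: "?j < n" "?j \<noteq> i"
      using that assms(1) by (auto simp: mod_Suc)
    have neq: "us ! i \<noteq> us ! ?j"
      using dist j that len nth_eq_iff_index_eq[of us i ?j] by (simp add: us_def)
    have mem: "us ! i \<in> {1..n}" "us ! ?j \<in> {1..n}"
      using set_us that j len nth_mem[of _ us] by (auto simp: us_def)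
    have us: "int (us ! i) = vs ! i mod int n + 1" "int (us ! ?j) = vs ! ?j mod int n + 1"
      using that j len f by (simp_all add: us_def)
    have "stripe n (us ! i) (us ! ?j)
        = nat (min ((vs ! ?j - vs ! i) mod int n) ((- (vs ! ?j - vs ! i)) mod int n))"
      unfolding stripe_def us by (simp add: mod_diff_eq min.commute)
    moreover have "\<not> int n dvd vs ! ?j - vs ! i"
      using neq us by (metis mod_eq_dvd_iff of_nat_eq_iff)
    ultimately show ?thesis
      using c[OF stripe_range[OF mem neq]]
      by (simp add: E_def edge_cost_doubleton circulant_cost_def)
  qed
  have "hamiltonian_cycle n (E ` {..<n})"
    unfolding hamiltonian_cycle_def
    using dist set_us by (intro exI[of _ us]) (auto simp: E_def)
  then have "TSPOPT n c \<le> (\<Sum>e\<in>E ` {..<n}. edge_cost n c e)"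
    unfolding TSPOPT_def using finite_hamiltonian_cycles by (intro Min_le) auto
  \<comment> \<open>An inequality suffices: as the costs are nonnegative, merging equal edges can
    only lower the sum.\<close>
  also have "\<dots> \<le> (\<Sum>i<n. edge_cost n c (E i))"
    using E_cost sum_image_le[of "{..<n}" "edge_cost n c" E] unfolding comp_def by blast
  also have "\<dots> = cycle_weight (circulant_cost n c) vs"
    using E_cost len assms(1) by (subst cycle_weight_conv_sum) auto
  finally show ?thesis .
qed


section \<open>Lower bound for the linear program\<close>

text \<open>A stripe is plus or minus the difference, reduced modulo \<open>n\<close>; neither the
  sign nor the reduction affects divisibility by a divisor of \<open>n\<close>.\<close>

lemma dvd_stripe_iff:
  assumes "g dvd n" "n > 0"
  shows "g dvd stripe n i j \<longleftrightarrow> i mod g = j mod g"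
proof -
  have "int (stripe n i j) = (int i - int j) mod int n \<or> int (stripe n i j) = (int j - int i) mod int n"
    using assms(2) by (auto simp: stripe_def min_def)
  moreover have "int g dvd x mod int n \<longleftrightarrow> int g dvd x" for x
    using assms(1) by (simp add: dvd_mod_iff)
  moreover have "int g dvd int j - int i \<longleftrightarrow> int g dvd int i - int j"
    by (rule dvd_diff_commute)
  ultimately have "int g dvd int (stripe n i j) \<longleftrightarrow> int g dvd int i - int j"
    by metis
  then show ?thesis
    by (simp add: flip: mod_eq_dvd_iff zmod_int)
qed

lemma edges_increasingE:
  assumes "e \<in> edges n"
  obtains i j where "e = {i, j}" "i < j" "i \<in> {1..n}" "j \<in> {1..n}"
proof -
  obtain i j where ij: "e = {i, j}" "i \<noteq> j" and "e \<subseteq> {1..n}"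
    using assms unfolding edges_def mem_Collect_eq card_2_iff by blast
  then have "i \<in> {1..n}" "j \<in> {1..n}"
    by auto
  then show thesis
    using that[of i j] that[of j i] ij by (cases "i < j") auto
qed

text \<open>Each edge is counted at most twice by the cuts of the residue classes modulo \<open>g\<close>.\<close>

lemma subtour_residue_cuts:
  assumes feas: "subtour_feasible n x" and "n > 0" "g dvd n" "g > 1"
  shows "real g \<le> (\<Sum>e | e \<in> edges n \<and> \<not> g dvd stripe n (Min e) (Max e). x e)"
proof -
  define S where "S r = {v \<in> {1..n}. v mod g = r}" for r
  let ?X = "{e \<in> edges n. \<not> g dvd stripe n (Min e) (Max e)}"
  have "g \<le> n"
    using assms by (simp add: dvd_imp_le)
  have cut: "2 \<le> (\<Sum>e\<in>delta n (S r). x e)" if "r < g" for r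
  proof -
    \<comment> \<open>Class 0 is represented by \<open>g\<close>, as 0 is no vertex. For the vertex
      outside, 1 serves for class 0 and \<open>g\<close> for any other class.\<close>
    have "(if r = 0 then g else r) \<in> S r"
      using that \<open>g \<le> n\<close> by (auto simp: S_def)
    moreover have "(if r = 0 then 1 else g) \<in> {1..n} - S r"
      using that \<open>g \<le> n\<close> \<open>g > 1\<close> by (auto simp: S_def)
    moreover have "S r \<subseteq> {1..n}"
      by (auto simp: S_def)
    ultimately have "S r \<noteq> {} \<and> S r \<subset> {1..n}"
      by blast
    then show ?thesis
      using feas by (simp add: subtour_feasible_def)
  qed
  have few: "card {r. r < g \<and> e \<in> delta n (S r)} \<le> (if e \<in> ?X then 2 else 0)"
    if e: "e \<in> edges n" for e
  proof -
    obtain i j where ij: "e = {i, j}" "i < j" "i \<in> {1..n}" "j \<in> {1..n}"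
      using e by (rule edges_increasingE)
    have X: "e \<in> ?X \<longleftrightarrow> i mod g \<noteq> j mod g"
      using e ij dvd_stripe_iff[OF \<open>g dvd n\<close> \<open>n > 0\<close>, of i j] by simp
    have "{r. r < g \<and> e \<in> delta n (S r)} \<subseteq> (if e \<in> ?X then {i mod g, j mod g} else {})"
    proof
      fix r assume "r \<in> {r. r < g \<and> e \<in> delta n (S r)}"
      then have 1: "card (e \<inter> S r) = 1"
        by (simp add: delta_def)
      have "e \<inter> S r = (if i mod g = r then {i} else {}) \<union> (if j mod g = r then {j} else {})"
        using ij by (auto simp: S_def)
      with 1 show "r \<in> (if e \<in> ?X then {i mod g, j mod g} else {})"
        unfolding X using ij(2) by (auto split: if_splits)
    qed
    then have "card {r. r < g \<and> e \<in> delta n (S r)} \<le> card (if e \<in> ?X then {i mod g, j mod g} else {})"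
      by (intro card_mono) auto
    also have "\<dots> \<le> (if e \<in> ?X then 2 else 0)"
      by (auto simp: card_insert_if)
    finally show ?thesis .
  qed
  have "2 * real g \<le> (\<Sum>r<g. \<Sum>e\<in>delta n (S r). x e)"
    using sum_mono[of "{..<g}" "\<lambda>_. 2" "\<lambda>r. \<Sum>e\<in>delta n (S r). x e"] cut by simp
  also have "\<dots> = (\<Sum>r<g. \<Sum>e\<in>edges n. if e \<in> delta n (S r) then x e else 0)"
    by (intro sum.cong sum.mono_neutral_cong_left) (auto simp: finite_edges delta_def)
  also have "\<dots> = (\<Sum>e\<in>edges n. \<Sum>r<g. if e \<in> delta n (S r) then x e else 0)"
    by (rule sum.swap)
  also have "\<dots> = (\<Sum>e\<in>edges n. real (card {r. r < g \<and> e \<in> delta n (S r)}) * x e)"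
    by (intro sum.cong refl) (simp add: sum.If_cases Int_def)
  also have "\<dots> \<le> (\<Sum>e\<in>edges n. (if e \<in> ?X then 2 else 0) * x e)"
  proof (intro sum_mono mult_right_mono)
    fix e assume e: "e \<in> edges n"
    show "real (card {r. r < g \<and> e \<in> delta n (S r)}) \<le> (if e \<in> ?X then 2 else 0)"
      using few[OF e, THEN of_nat_mono[where 'a = real]]
      by (simp only: if_distrib[of real] of_nat_numeral of_nat_0)
    show "x e \<ge> 0"
      using feas e by (simp add: subtour_feasible_def)
  qed
  also have "\<dots> = (\<Sum>e\<in>?X. 2 * x e)"
    by (rule sum.mono_neutral_cong_right) (auto simp: finite_edges)
  finally show ?thesis
    by (simp flip: sum_distrib_left)
qed

text \<open>Summation by parts: the sum is \<open>c 0\<close> times the full tail plus the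
  increments of \<open>c\<close> times the later tails, all nonnegative. The proof runs downward in
  \<open>k\<close>, replacing \<open>c k\<close> by \<open>c (Suc k)\<close> on the remaining
  tail.\<close>

lemma sum_mult_nonneg_if_tails_nonneg:
  fixes c u :: "nat \<Rightarrow> real"
  assumes mono: "\<And>i j. i \<le> j \<Longrightarrow> j < d \<Longrightarrow> c i \<le> c j" and pos: "\<And>i. i < d \<Longrightarrow> c i \<ge> 0"
    and tails: "\<And>k. k < d \<Longrightarrow> (\<Sum>i=k..<d. u i) \<ge> 0"
  shows "(\<Sum>i<d. c i * u i) \<ge> 0"
proof (cases "d = 0")
  case False
  have "c k * (\<Sum>i=k..<d. u i) \<le> (\<Sum>i=k..<d. c i * u i)" if "k < d" for k
    using that
  proof (induction "d - k" arbitrary: k)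
    case (Suc m)
    show ?case
    proof (cases "Suc k = d")
      case True
      then show ?thesis
        by auto
    next
      case False
      then have k: "Suc k < d"
        using Suc.prems by simp
      have "c k * (\<Sum>i=Suc k..<d. u i) \<le> c (Suc k) * (\<Sum>i=Suc k..<d. u i)"
        using k mono[of k "Suc k"] tails by (intro mult_right_mono) auto
      also have "\<dots> \<le> (\<Sum>i=Suc k..<d. c i * u i)"
        using Suc k by auto
      finally show ?thesis
        using Suc.prems by (simp add: sum.atLeast_Suc_lessThan algebra_simps)
    qed
  qed simp
  from this[of 0] pos[of 0] tails[of 0] False have "0 \<le> (\<Sum>i=0..<d. c i * u i)"
    by (meson gr0I mult_nonneg_nonneg order_trans)
  then show ?thesis
    by (simp add: atLeast0LessThan)
qed simp

lemma foldl_gcd_dvd: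
  "foldl gcd (g :: nat) as dvd g" "a \<in> set as \<Longrightarrow> foldl gcd g as dvd a"
  by (induction as arbitrary: g) (auto intro: dvd_trans)

text \<open>Since costs increase along \<open>ss\<close>, it is enough to compare tails: the LP
  weight \<open>y\<close> on the stripes from index \<open>k\<close> on must be at least the
  telescoping sum \<open>G k - 1\<close>. The residue cuts modulo \<open>G k\<close> supply
  this.\<close>

lemma LP_objective_lower_bound:
  assumes "n \<ge> 2" and c: "\<And>k. k \<in> {1..n div 2} \<Longrightarrow> c k \<ge> 0" and feas: "subtour_feasible n x"
    and ss: "distinct ss" "set ss = {1..n div 2}" "sorted (map c ss)"
  shows "(\<Sum>i<length ss. (real (foldl gcd n (take i ss)) - real (foldl gcd n (take (Suc i) ss)))
        * c (ss ! i)) \<le> (\<Sum>e\<in>edges n. edge_cost n c e * x e)"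
proof -
  define d where "d = length ss"
  define G where "G i = foldl gcd n (take i ss)" for i
  define st where "st e = stripe n (Min e) (Max e)" for e :: "nat set"
  define y where "y i = (\<Sum>e | e \<in> edges n \<and> st e = ss ! i. x e)" for i
  have st: "st e \<in> set ss" if e: "e \<in> edges n" for e
  proof -
    obtain i j where ij: "e = {i, j}" "i < j" "i \<in> {1..n}" "j \<in> {1..n}"
      using e by (rule edges_increasingE)
    then show ?thesis
      unfolding ss(2) st_def using stripe_range[of i n j] by simp
  qed
  have "1 \<in> set ss"
    using ss(2) assms(1) by simp
  then have Gd: "G d = 1"
    using foldl_gcd_dvd(2)[of 1 ss n] by (simp add: G_def d_def)
  have split: "(\<Sum>e | e \<in> edges n \<and> st e \<in> (!) ss ` I. f e)
      = (\<Sum>i\<in>I. \<Sum>e | e \<in> edges n \<and> st e = ss ! i. f e)" if "I \<subseteq> {..<d}" for I and f :: "nat set \<Rightarrow> real"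
  proof -
    have "finite I"
      using that finite_subset by blast
    have *: "{e \<in> edges n. st e \<in> (!) ss ` I} = (\<Union>i\<in>I. {e \<in> edges n. st e = ss ! i})"
      by auto
    have "ss ! i \<noteq> ss ! j" if "i \<in> I" "j \<in> I" "i \<noteq> j" for i j
      using that \<open>I \<subseteq> {..<d}\<close> nth_eq_iff_index_eq[OF ss(1), of i j]
      by (auto simp: d_def subset_iff)
    then show ?thesis
      unfolding * using \<open>finite I\<close> finite_edges[of n] by (subst sum.UNION_disjoint) auto
  qed
  have all: "(!) ss ` {..<d} = set ss"
    by (auto simp: d_def set_conv_nth)
  have "(\<Sum>e\<in>edges n. edge_cost n c e * x e)
      = (\<Sum>e | e \<in> edges n \<and> st e \<in> (!) ss ` {..<d}. c (st e) * x e)"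
    by (rule sum.cong) (auto simp: all st edge_cost_def st_def[symmetric])
  also have "\<dots> = (\<Sum>i<d. \<Sum>e | e \<in> edges n \<and> st e = ss ! i. c (st e) * x e)"
    by (rule split) simp
  also have "\<dots> = (\<Sum>i<d. c (ss ! i) * y i)"
    unfolding y_def sum_distrib_left by (intro sum.cong) auto
  finally have cost: "(\<Sum>e\<in>edges n. edge_cost n c e * x e) = (\<Sum>i<d. c (ss ! i) * y i)" .
  have "(\<Sum>i=k..<d. y i - (real (G i) - real (G (Suc i)))) \<ge> 0" if "k < d" for k
  proof -
    have tele: "(\<Sum>i=k..<d. real (G i) - real (G (Suc i))) = real (G k) - 1"
      using sum_Suc_diff'[of k d "\<lambda>i. - real (G i)"] that Gd by (simp add: algebra_simps)
    have ynn: "x e \<ge> 0" if "e \<in> edges n" for e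
      using feas that by (simp add: subtour_feasible_def)
    have "real (G k) - 1 \<le> (\<Sum>i=k..<d. y i)"
    proof (cases "G k > 1")
      case True
      have "real (G k) \<le> (\<Sum>e | e \<in> edges n \<and> \<not> G k dvd st e. x e)"
        unfolding st_def using assms(1) True foldl_gcd_dvd(1)
        by (intro subtour_residue_cuts[OF feas]) (auto simp: G_def)
      \<comment> \<open>Stripes with index below \<open>k\<close> are multiples of
        \<open>G k\<close>, so an edge joining different classes lies in a stripe of index at least
        \<open>k\<close>.\<close>
      also have "\<dots> \<le> (\<Sum>e | e \<in> edges n \<and> st e \<in> (!) ss ` {k..<d}. x e)"
      proof (rule sum_mono2)
        show "{e \<in> edges n. \<not> G k dvd st e} \<subseteq> {e \<in> edges n. st e \<in> (!) ss ` {k..<d}}"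
        proof safe
          fix e assume e: "e \<in> edges n" "\<not> G k dvd st e"
          obtain i where i: "i < d" "st e = ss ! i"
            using st[OF e(1)] by (auto simp: in_set_conv_nth d_def)
          have "\<not> i < k"
          proof
            assume "i < k"
            then have "ss ! i \<in> set (take k ss)"
              using i by (auto simp: in_set_conv_nth d_def intro!: exI[of _ i])
            then show False
              using e(2) i(2) foldl_gcd_dvd(2) unfolding G_def by metis
          qed
          then show "st e \<in> (!) ss ` {k..<d}"
            using i by auto
        qed
      qed (use finite_edges ynn in auto)
      also have "\<dots> = (\<Sum>i=k..<d. y i)"
        unfolding y_def by (rule split) auto
      finally show ?thesis
        by simp
    next
      case False
      \<comment> \<open>A single class gives no cut, but then \<open>G k - 1\<close> is at most
        0.\<close>
      have "(\<Sum>i=k..<d. y i) \<ge> 0"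
        unfolding y_def using ynn by (intro sum_nonneg) auto
      then show ?thesis
        using False by simp
    qed
    then show ?thesis
      unfolding sum_subtractf[of y] tele by simp
  qed
  then have "(\<Sum>i<d. c (ss ! i) * (y i - (real (G i) - real (G (Suc i))))) \<ge> 0"
  proof (intro sum_mult_nonneg_if_tails_nonneg)
    show "c (ss ! i) \<le> c (ss ! j)" if "i \<le> j" "j < d" for i j
      using sorted_nth_mono[OF ss(3), of i j] that by (simp add: d_def)
    show "c (ss ! i) \<ge> 0" if "i < d" for i
      using c ss(2) nth_mem[of i ss] that by (simp add: d_def)
  qed auto
  then show ?thesis
    unfolding cost G_def[symmetric] d_def[symmetric]
    by (simp add: right_diff_distrib sum_subtractf mult.commute)
qed

section \<open>Combining both bounds\<close>

theorem theorem2: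
  fixes n :: nat and c :: "nat \<Rightarrow> real"
  assumes "n \<ge> 3"
    and "\<And>k. k \<in> {1..n div 2} \<Longrightarrow> c k \<ge> 0"
  shows "TSPOPT n c \<le> 2 * LPOPT n c"
proof -
  define ss where "ss = sort_key c [1..<Suc (n div 2)]"
  define w where "w = circulant_cost n c"
  have ss: "distinct ss" "set ss = {1..n div 2}" "sorted (map c ss)"
    by (auto simp: ss_def simp del: upt_Suc)
  interpret circulant_weight n w
    unfolding w_def using assms by (intro circulant_weight_circulant_cost) auto
  \<comment> \<open>Stripe 1 occurs in the list, so the final gcd is 1 and the tour visits every
    vertex.\<close>
  have "1 \<in> set ss"
    using ss(2) assms(1) by simp
  then have "foldl gcd n ss = 1"
    using foldl_gcd_dvd(2)[of 1 ss n] by simp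
  moreover have "w 0 = 0"
    by (simp add: w_def circulant_cost_def)
  ultimately obtain vs where vs: "subgroup_tour n 1 vs" "cycle_weight w vs
    \<le> 2 * (\<Sum>i<length ss. (real (foldl gcd n (take i ss)) - real (foldl gcd n (take (Suc i) ss)))
             * w (int (ss ! i)))"
    using subgroup_tour_exists[of ss] assms(1) by auto
  have "w (int (ss ! i)) = c (ss ! i)" if "i < length ss" for i
    unfolding w_def using that nth_mem[of i ss] ss(2) by (intro circulant_cost_stripe) simp
  with vs(2) have le: "cycle_weight w vs
    \<le> 2 * (\<Sum>i<length ss. (real (foldl gcd n (take i ss)) - real (foldl gcd n (take (Suc i) ss)))
             * c (ss ! i))"
    by simp
  have "TSPOPT n c \<le> cycle_weight w vs"
    unfolding w_def by (rule TSPOPT_le_cycle_weight[OF assms vs(1)])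
  with le have "TSPOPT n c / 2 \<le> (\<Sum>e\<in>edges n. edge_cost n c e * x e)"
    if "subtour_feasible n x" for x
    using LP_objective_lower_bound[OF _ assms(2) that ss] assms(1) by simp
  \<comment> \<open>The uniform solution makes the set of objective values nonempty, so their common
    lower bound also bounds the infimum.\<close>
  then have "TSPOPT n c / 2 \<le> LPOPT n c"
    unfolding LPOPT_def using subtour_feasible_uniform[OF assms(1)] by (intro cInf_greatest) auto
  then show ?thesis
    by simp
qed

end
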